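(* (Discounted mean-variance performance difference formula.) Let $\mathcal{M}=\langle S,A,r,p,\mu,\alpha\rangle$ be a finite discounted Markov decision process, let $\beta>0$, let $d,d'\in D$ be two stationary deterministic policies and let $\lambda\in\mathbb{R}$. Write $\mathbf{P}=\mathbf{P}_d$, $\mathbf{P}'=\mathbf{P}_{d'}$, $\mathbf{f}_\lambda=\mathbf{f}_{\lambda,d}$, $\mathbf{f}'_\lambda=\mathbf{f}_{\lambda,d'}$, $\mathbf{u}_\lambda=\mathbf{u}_{\lambda,d}$, $\eta=\eta_d$, $\eta'=\eta_{d'}$, $\xi=\xi_d$, $\xi'=\xi_{d'}$. Then $$\xi'-\xi=\boldsymbol{\mu}(\mathbf{I}-\alpha\mathbf{P}')^{-1}\left[(1-\alpha)(\mathbf{f}'_\lambda-\mathbf{f}_\lambda)+\alpha(\mathbf{P}'-\mathbf{P})\mathbf{u}_\lambda\right]+\beta(\eta'-\lambda)^2-\beta(\eta-\lambda)^2.$$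
   Context: $S$ is a finite state space; $A(x)$ is the set of admissible actions at $x\in S$ and $A=\bigcup_x A(x)$ is finite; $r(x,a)\in\mathbb{R}$ is the reward; $p(y\mid x,a)$ are the transition probabilities; $\mu$ is the initial distribution on $S$, written as a row vector $\boldsymbol{\mu}$; $\alpha\in(0,1)$ is the discount factor. $D$ is the set of stationary deterministic policies $d$, $d(x)\in A(x)$. For $d\in D$: $P_d(x,y)=p(y\mid x,d(x))$ defines the matrix $\mathbf{P}_d$, and $r_d(x)=r(x,d(x))$ the column vector $\mathbf{r}_d$. The discounted mean is $\eta_d=(1-\alpha)\boldsymbol{\mu}(\mathbf{I}-\alpha\mathbf{P}_d)^{-1}\mathbf{r}_d$. For a pseudo mean $\lambda\in\mathbb{R}$, the pseudo reward vector $\mathbf{f}_{\lambda,d}$ has entries $r_d(x)-\beta(r_d(x)-\lambda)^2$, and the pseudo discounted mean-variance value function is $\mathbf{u}_{\lambda,d}=(1-\alpha)(\mathbf{I}-\alpha\mathbf{P}_d)^{-1}\mathbf{f}_{\lambda,d}$. The discounted mean-variance is $\xi_d=(1-\alpha)\boldsymbol{\mu}(\mathbf{I}-\alpha\mathbf{P}_d)^{-1}\mathbf{f}_{\eta_d,d}$, i.e. the expected normalized discounted sum $(1-\alpha)\mathbb{E}^d_\mu\{\sum_{t\ge1}\alpha^{t-1}(r(X_t)-\beta[r(X_t)-\eta_d]^2)\}$. *)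

theory Defs
  imports "HOL-Analysis.Analysis"
begin

text \<open>The state space is the finite type \<open>'s\<close>; \<open>transition M x a y\<close> is \<open>p(y | x, a)\<close>.\<close>

record ('s, 'a) dmdp =
  actions :: "'s \<Rightarrow> 'a set"
  reward :: "'s \<Rightarrow> 'a \<Rightarrow> real"
  transition :: "'s \<Rightarrow> 'a \<Rightarrow> 's \<Rightarrow> real"
  initial :: "real ^ 's"
  discount :: real

definition finite_dmdp :: "('s::finite, 'a) dmdp \<Rightarrow> bool" where
  "finite_dmdp M \<longleftrightarrow>
     finite (\<Union>x. actions M x) \<and>
     (\<forall>x. actions M x \<noteq> {}) \<and>
     (\<forall>x. \<forall>a\<in>actions M x. (\<forall>y. 0 \<le> transition M x a y) \<and> (\<Sum>y\<in>UNIV. transition M x a y) = 1) \<and>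
     (\<forall>x. 0 \<le> initial M $ x) \<and> (\<Sum>x\<in>UNIV. initial M $ x) = 1 \<and>
     0 < discount M \<and> discount M < 1"

definition policies :: "('s::finite, 'a) dmdp \<Rightarrow> ('s \<Rightarrow> 'a) set" where
  "policies M = {d. \<forall>x. d x \<in> actions M x}"

definition trans_matrix :: "('s::finite, 'a) dmdp \<Rightarrow> ('s \<Rightarrow> 'a) \<Rightarrow> real ^ 's ^ 's" where
  "trans_matrix M d = (\<chi> x y. transition M x (d x) y)"

definition reward_vec :: "('s::finite, 'a) dmdp \<Rightarrow> ('s \<Rightarrow> 'a) \<Rightarrow> real ^ 's" where
  "reward_vec M d = (\<chi> x. reward M x (d x))"

text \<open>A product of a row vector \<open>m\<close>, a matrix \<open>A\<close> and a column vector \<open>f\<close> is written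
  \<open>(m v* A) \<bullet> f\<close>. For admissible policies the transition matrix is stochastic and the discount factor is
  below 1, so the \<open>matrix_inv\<close> below is a genuine inverse.\<close>

definition disc_mean :: "('s::finite, 'a) dmdp \<Rightarrow> ('s \<Rightarrow> 'a) \<Rightarrow> real" where
  "disc_mean M d =
     (1 - discount M) *
     ((initial M v* matrix_inv (mat 1 - discount M *\<^sub>R trans_matrix M d)) \<bullet> reward_vec M d)"

definition pseudo_reward ::
    "('s::finite, 'a) dmdp \<Rightarrow> real \<Rightarrow> real \<Rightarrow> ('s \<Rightarrow> 'a) \<Rightarrow> real ^ 's" where
  "pseudo_reward M \<beta> l d = (\<chi> x. reward_vec M d $ x - \<beta> * (reward_vec M d $ x - l)\<^sup>2)"

definition pseudo_value ::
    "('s::finite, 'a) dmdp \<Rightarrow> real \<Rightarrow> real \<Rightarrow> ('s \<Rightarrow> 'a) \<Rightarrow> real ^ 's" where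
  "pseudo_value M \<beta> l d =
     (1 - discount M) *\<^sub>R
     (matrix_inv (mat 1 - discount M *\<^sub>R trans_matrix M d) *v pseudo_reward M \<beta> l d)"

definition disc_mean_variance :: "('s::finite, 'a) dmdp \<Rightarrow> real \<Rightarrow> ('s \<Rightarrow> 'a) \<Rightarrow> real" where
  "disc_mean_variance M \<beta> d =
     (1 - discount M) *
     ((initial M v* matrix_inv (mat 1 - discount M *\<^sub>R trans_matrix M d)) \<bullet>
      pseudo_reward M \<beta> (disc_mean M d) d)"

end

theory Submission
  imports Defs
begin

text \<open>Pairing with \<open>\<mu>(I - \<alpha>P)\<^sup>-\<^sup>1\<close> is, up to the factor \<open>1 - \<alpha>\<close>, an expectation,
  so replacing the pseudo mean \<open>\<lambda>\<close> by the true mean \<open>\<eta>\<close> raises the value by the bias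
  \<open>\<beta>(\<eta> - \<lambda>)\<^sup>2\<close>. What remains is the performance difference formula for the fixed
  reward \<open>f\<^sub>\<lambda>\<close>, which follows from \<open>\<alpha>(P' - P) = (I - \<alpha>P) - (I - \<alpha>P')\<close>.\<close>

text \<open>A maximum principle: a kernel vector satisfies \<open>v = a *\<^sub>R (P *v v)\<close>,
  and averaging with nonnegative weights of total at most 1 cannot increase the largest modulus
  \<open>N\<close> of its entries. Hence \<open>N \<le> a * N\<close>, which forces
  \<open>N = 0\<close> because \<open>a < 1\<close>; a square matrix with trivial kernel is
  invertible.\<close>

lemma invertible_mat_minus_substochastic:
  fixes P :: "real ^ 'n ^ 'n"
  assumes nonneg: "\<And>x y. 0 \<le> P $ x $ y" and row: "\<And>x. (\<Sum>y\<in>UNIV. P $ x $ y) \<le> 1"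
    and a: "0 \<le> a" "a < 1"
  shows "invertible (mat 1 - a *\<^sub>R P)"
  unfolding invertible_left_inverse matrix_left_invertible_ker
proof (intro allI impI)
  fix v :: "real ^ 'n"
  assume "(mat 1 - a *\<^sub>R P) *v v = 0"
  then have v: "v = a *\<^sub>R (P *v v)"
    by (simp add: matrix_vector_mult_diff_rdistrib scaleR_matrix_vector_assoc)
  define N where "N = Max (range (\<lambda>x. \<bar>v $ x\<bar>))"
  have le: "\<bar>v $ x\<bar> \<le> N" for x
    unfolding N_def by (rule Max_ge) auto
  have "N \<in> range (\<lambda>x. \<bar>v $ x\<bar>)"
    unfolding N_def by (rule Max_in) auto
  then obtain x where x: "N = \<bar>v $ x\<bar>"
    by blast
  have N0: "0 \<le> N"
    using x by simp
  have "N = a * \<bar>\<Sum>y\<in>UNIV. P $ x $ y * v $ y\<bar>"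
    unfolding x
    \<comment> \<open>Only the left-hand occurrence of \<open>v\<close> is replaced; as a
      simplification rule the equation would loop.\<close>
    by (subst v) (simp add: matrix_vector_mult_def abs_mult a)
  also have "\<dots> \<le> a * (\<Sum>y\<in>UNIV. \<bar>P $ x $ y * v $ y\<bar>)"
    by (intro mult_left_mono sum_abs a)
  also have "\<dots> \<le> a * (\<Sum>y\<in>UNIV. P $ x $ y * N)"
    using nonneg le by (intro mult_left_mono sum_mono a) (simp add: abs_mult mult_left_mono)
  also have "\<dots> \<le> a * N"
    using row[of x] N0 a
    by (simp add: sum_distrib_right[symmetric] mult_left_mono mult_left_le_one_le nonneg sum_nonneg)
  finally have "(1 - a) * N \<le> 0"
    by (simp add: algebra_simps)
  then have "N \<le> 0"
    using a by (simp add: mult_le_0_iff)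
  then show "v = 0"
    using le by (simp add: vec_eq_iff) (metis abs_le_zero_iff order_trans)
qed

lemma matrix_inv_inverse:
  assumes "invertible B"
  shows "B ** matrix_inv B = mat 1" and "matrix_inv B ** B = mat 1"
  using someI_ex[OF assms[unfolded invertible_def]] by (auto simp: matrix_inv_def)

context
  fixes M :: "('s::finite, 'a) dmdp" and d :: "'s \<Rightarrow> 'a"
  assumes M: "finite_dmdp M" and d: "d \<in> policies M"
begin

private abbreviation (input) A :: "real ^ 's ^ 's" where
  "A \<equiv> mat 1 - discount M *\<^sub>R trans_matrix M d"

lemma invertible_mat_minus_trans_matrix: "invertible A"
  using M d
  by (intro invertible_mat_minus_substochastic)
     (auto simp: finite_dmdp_def policies_def trans_matrix_def)

lemma resolvent_right: "A *v (matrix_inv A *v v) = v"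
  by (simp add: matrix_vector_mul_assoc matrix_inv_inverse invertible_mat_minus_trans_matrix)

lemma resolvent_left: "matrix_inv A *v (A *v v) = v"
  by (simp add: matrix_vector_mul_assoc matrix_inv_inverse invertible_mat_minus_trans_matrix)

text \<open>Since the rows of the transition matrix sum to 1, the all-ones vector is an eigenvector
  of \<open>A\<close> with eigenvalue \<open>1 - discount M\<close>. The pairing therefore has total
  mass 1 after normalization.\<close>

lemma initial_resolvent_one:
  "(1 - discount M) * ((initial M v* matrix_inv A) \<bullet> 1) = 1"
proof -
  have "A *v 1 = (1 - discount M) *\<^sub>R (1 :: real ^ 's)"
    using M d
    by (simp add: vec_eq_iff matrix_vector_mult_diff_rdistrib scaleR_matrix_vector_assoc[symmetric]
        finite_dmdp_def policies_def trans_matrix_def matrix_vector_mult_def[of "vec_lambda _"])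
  then have "(1 - discount M) *\<^sub>R (matrix_inv A *v 1) = 1"
    by (metis resolvent_left matrix_vector_mult_scaleR)
  then have "(1 - discount M) * (initial M \<bullet> (matrix_inv A *v 1)) = initial M \<bullet> 1"
    by (metis inner_scaleR_right)
  also have "\<dots> = 1"
    using M by (simp add: finite_dmdp_def inner_vec_def)
  finally show ?thesis
    by (simp add: dot_lmul_matrix)
qed

text \<open>The pseudo mean \<open>l\<close> is arbitrary, so two policies with different means can
  be compared through the same pseudo reward.\<close>

lemma disc_mean_variance_pseudo_mean:
  "disc_mean_variance M \<beta> d =
     (1 - discount M) * ((initial M v* matrix_inv A) \<bullet> pseudo_reward M \<beta> l d)
     + \<beta> * (disc_mean M d - l)\<^sup>2"
proof -
  define m where "m = initial M v* matrix_inv A"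
  define e where "e = disc_mean M d"
  \<comment> \<open>The squares of the reward cancel between the two pseudo means, leaving a
    correction affine in the reward. Its expectation needs only the mean \<open>e\<close> and the
    total mass 1.\<close>
  have "pseudo_reward M \<beta> e d =
      pseudo_reward M \<beta> l d + (\<beta> * (e - l)) *\<^sub>R (2 *\<^sub>R reward_vec M d - (e + l) *\<^sub>R 1)"
    by (simp add: vec_eq_iff pseudo_reward_def power2_eq_square algebra_simps)
  then have "(1 - discount M) * (m \<bullet> pseudo_reward M \<beta> e d) =
      (1 - discount M) * (m \<bullet> pseudo_reward M \<beta> l d) + \<beta> * (e - l) *
        (2 * ((1 - discount M) * (m \<bullet> reward_vec M d)) - (e + l) * ((1 - discount M) * (m \<bullet> 1)))"
    by (simp only: inner_add_right inner_diff_right inner_scaleR_right) (simp add: algebra_simps)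
  also have "(1 - discount M) * (m \<bullet> reward_vec M d) = e"
    by (simp add: e_def m_def disc_mean_def)
  also have "(1 - discount M) * (m \<bullet> 1) = 1"
    unfolding m_def by (rule initial_resolvent_one)
  also have "\<beta> * (e - l) * (2 * e - (e + l) * 1) = \<beta> * (e - l)\<^sup>2"
    by (simp add: power2_eq_square algebra_simps)
  finally show ?thesis
    by (simp add: disc_mean_variance_def m_def e_def)
qed

text \<open>This is the Bellman equation of the fixed policy \<open>d\<close>, with the discounted
  transition term moved to the left.\<close>

lemma resolvent_pseudo_value:
  "A *v pseudo_value M \<beta> l d = (1 - discount M) *\<^sub>R pseudo_reward M \<beta> l d"
  by (simp add: pseudo_value_def matrix_vector_mult_scaleR resolvent_right)

text \<open>The vector \<open>v\<close> is arbitrary because the value function of another policy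
  will be inserted.\<close>

lemma initial_resolvent_inner: "(initial M v* matrix_inv A) \<bullet> (A *v v) = initial M \<bullet> v"
  by (simp add: dot_lmul_matrix resolvent_left)

lemma initial_inner_pseudo_value:
  "initial M \<bullet> pseudo_value M \<beta> l d =
     (1 - discount M) * ((initial M v* matrix_inv A) \<bullet> pseudo_reward M \<beta> l d)"
  by (simp add: pseudo_value_def dot_lmul_matrix)

end

theorem mainTheorem2:
  fixes M :: "('s::finite, 'a) dmdp"
    and d d' :: "'s \<Rightarrow> 'a"
    and \<beta> l :: real
  assumes "finite_dmdp M"
    and "\<beta> > 0"
    and "d \<in> policies M"
    and "d' \<in> policies M"
  shows "disc_mean_variance M \<beta> d' - disc_mean_variance M \<beta> d =
    (initial M v* matrix_inv (mat 1 - discount M *\<^sub>R trans_matrix M d')) \<bullet>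
      ((1 - discount M) *\<^sub>R (pseudo_reward M \<beta> l d' - pseudo_reward M \<beta> l d)
       + discount M *\<^sub>R ((trans_matrix M d' - trans_matrix M d) *v pseudo_value M \<beta> l d))
    + \<beta> * (disc_mean M d' - l)\<^sup>2 - \<beta> * (disc_mean M d - l)\<^sup>2"
proof -
  let ?A = "\<lambda>d. mat 1 - discount M *\<^sub>R trans_matrix M d"
  let ?m = "\<lambda>d. initial M v* matrix_inv (?A d)"
  let ?f = "pseudo_reward M \<beta> l"
  let ?u = "pseudo_value M \<beta> l d"
  have "discount M *\<^sub>R ((trans_matrix M d' - trans_matrix M d) *v ?u) = ?A d *v ?u - ?A d' *v ?u"
    by (simp add: matrix_vector_mult_diff_rdistrib scaleR_matrix_vector_assoc[symmetric]
        scaleR_diff_right)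
  \<comment> \<open>The term \<open>?A d *v ?u\<close> cancels the pseudo reward of \<open>d\<close>
    by the Bellman equation, while \<open>?A d' *v ?u\<close> pairs with \<open>?m d'\<close> to
    give \<open>initial M \<bullet> ?u\<close>, the value of \<open>d\<close> itself.\<close>
  then have "?m d' \<bullet> ((1 - discount M) *\<^sub>R (?f d' - ?f d)
      + discount M *\<^sub>R ((trans_matrix M d' - trans_matrix M d) *v ?u))
    = (1 - discount M) * (?m d' \<bullet> ?f d') - (1 - discount M) * (?m d \<bullet> ?f d)"
    using assms
    by (simp add: resolvent_pseudo_value initial_resolvent_inner initial_inner_pseudo_value
        inner_add_right inner_diff_right right_diff_distrib)
  then show ?thesis
    using assms by (simp add: disc_mean_variance_pseudo_mean[where l = l])
qed

end
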